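(* Let $(Z_n)$ be a sequence of random elements (on a common probability space) in a Polish space $(\mathbb E,\rho)$ equipped with the Borel $\sigma$-algebra. Then $Z_n$ converges in probability to an $\mathbb E$-valued random element if and only if for every pair of subsequences $Z_l$ and $Z_m$ of $(Z_n)$ there exists a subsequence $v_k:=(Z_{l(k)},Z_{m(k)})$ of the sequence of pairs $(Z_l,Z_m)$ converging weakly to a random element $v$ supported on the diagonal $\{(x,y)\in\mathbb E\times\mathbb E:\ x=y\}$.
   Context: Weak convergence means convergence in distribution of $\mathbb E\times\mathbb E$-valued random elements. $\rho$ is a complete separable metric on $\mathbb E$. *)

theory Defs
  imports "HOL-Probability.Probability"
begin

definition converges_in_prob ::
    "'w measure \<Rightarrow> (nat \<Rightarrow> 'w \<Rightarrow> 'a::metric_space) \<Rightarrow> ('w \<Rightarrow> 'a) \<Rightarrow> bool" where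
  "converges_in_prob M X Y \<longleftrightarrow>
     (\<forall>\<epsilon>>0. (\<lambda>n. measure M {\<omega> \<in> space M. dist (X n \<omega>) (Y \<omega>) > \<epsilon>}) \<longlonglongrightarrow> 0)"

(* The library's weak_conv_m concerns laws on the real line only, hence this general version. *)
definition weakly_converges ::
    "(nat \<Rightarrow> 'b::topological_space measure) \<Rightarrow> 'b measure \<Rightarrow> bool" where
  "weakly_converges \<mu> \<nu> \<longleftrightarrow>
     (\<forall>f::'b \<Rightarrow> real. continuous_on UNIV f \<and> bounded (range f) \<longrightarrow>
        (\<lambda>k. \<integral>x. f x \<partial>\<mu> k) \<longlonglongrightarrow> (\<integral>x. f x \<partial>\<nu>))"

(* The limit Y may live on a probability space N different from that of the sequence X. *)
definition converges_in_distr ::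
    "'w measure \<Rightarrow> (nat \<Rightarrow> 'w \<Rightarrow> 'b::topological_space) \<Rightarrow> 'v measure \<Rightarrow> ('v \<Rightarrow> 'b) \<Rightarrow> bool" where
  "converges_in_distr M X N Y \<longleftrightarrow>
     weakly_converges (\<lambda>k. distr M borel (X k)) (distr N borel Y)"

(* "X converges weakly to some random element v supported on D". A type cannot be quantified
   existentially, so the probability space carrying v is taken over the type 'b of the values;
   this is no restriction, as any v on any probability space can be replaced by the identity on
   the space 'b equipped with the law of v. *)
definition converges_weakly_to_supported_on ::
    "'w measure \<Rightarrow> (nat \<Rightarrow> 'w \<Rightarrow> 'b::topological_space) \<Rightarrow> 'b set \<Rightarrow> bool" where
  "converges_weakly_to_supported_on M X D \<longleftrightarrow>
     (\<exists>(N :: 'b measure) (v :: 'b \<Rightarrow> 'b).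
        prob_space N \<and> v \<in> borel_measurable N \<and>
        converges_in_distr M X N v \<and> (AE \<omega> in N. v \<omega> \<in> D))"

end

theory Submission
  imports Defs
begin

text \<open>The truncated distance \<open>min 1 (dist x y)\<close> is bounded and continuous on pairs and vanishes
  exactly on the diagonal. Its mean along two random elements therefore plays two roles at once.
  On the one hand it is a pseudometric on random elements that induces convergence in
  probability (\<open>converges_in_prob_iff_mean_dist\<close>) and is complete
  (\<open>mean_dist_complete\<close>). On the other hand it is the integral of a bounded continuous
  function against the joint law of the two elements, so it passes to weak limits of joint laws,
  where it becomes zero if the limit law sits on the diagonal.

  If subsequences of pairs converge weakly to laws on the diagonal, the sequence must be Cauchy for
  the mean truncated distance: otherwise there are two subsequences whose terms of equal rank
  stay at least a fixed mean distance apart, which the weak limit forbids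
  (\<open>mean_dist_Cauchy_if_weak_limits_on_diagonal\<close>). Completeness then supplies the limit.
  Conversely, if the sequence tends to \<open>Y\<close> in probability, then along a common
  subsequence both members of the pair tend to \<open>Y\<close> almost surely, so by dominated convergence
  the pairs tend weakly to \<open>(Y, Y)\<close>, which lies on the diagonal.\<close>

section \<open>The mean truncated distance\<close>

definition trunc_dist :: "'a::metric_space \<Rightarrow> 'a \<Rightarrow> real" where
  "trunc_dist x y = min 1 (dist x y)"

definition mean_dist :: "'w measure \<Rightarrow> ('w \<Rightarrow> 'a::metric_space) \<Rightarrow> ('w \<Rightarrow> 'a) \<Rightarrow> real" where
  "mean_dist M X Y = (\<integral>\<omega>. trunc_dist (X \<omega>) (Y \<omega>) \<partial>M)"

lemma trunc_dist_nonneg [simp]: "0 \<le> trunc_dist x y"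
  and trunc_dist_le_1 [simp]: "trunc_dist x y \<le> 1"
  and trunc_dist_self [simp]: "trunc_dist x x = 0"
  by (auto simp: trunc_dist_def)

lemma abs_trunc_dist_le_1 [simp]: "\<bar>trunc_dist x y\<bar> \<le> 1"
  using trunc_dist_nonneg[of x y] trunc_dist_le_1[of x y] by linarith

lemma trunc_dist_triangle: "trunc_dist x z \<le> trunc_dist x y + trunc_dist y z"
  using dist_triangle[of x z y] zero_le_dist[of x y] zero_le_dist[of y z]
  unfolding trunc_dist_def by linarith

lemma continuous_on_trunc_dist:
  "continuous_on UNIV (\<lambda>p::'a::metric_space \<times> 'a. trunc_dist (fst p) (snd p))"
  unfolding trunc_dist_def by (intro continuous_intros)

lemma borel_measurable_trunc_dist [measurable (raw)]:
  fixes X Y :: "'w \<Rightarrow> 'a::{metric_space, second_countable_topology}"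
  assumes [measurable]: "X \<in> borel_measurable M" "Y \<in> borel_measurable M"
  shows "(\<lambda>\<omega>. trunc_dist (X \<omega>) (Y \<omega>)) \<in> borel_measurable M"
  unfolding trunc_dist_def by measurable

lemma tendsto_if_trunc_dist_tendsto_0:
  assumes "(\<lambda>n. trunc_dist (x n) y) \<longlonglongrightarrow> 0"
  shows "x \<longlonglongrightarrow> y"
proof (rule tendstoI)
  fix e :: real assume "0 < e"
  then have "\<forall>\<^sub>F n in sequentially. trunc_dist (x n) y < min 1 e"
    by (intro order_tendstoD[OF assms]) auto
  then show "\<forall>\<^sub>F n in sequentially. dist (x n) y < e"
    by eventually_elim (auto simp: trunc_dist_def)
qed

lemma trunc_dist_tendsto_0_if_tendsto:
  assumes "x \<longlonglongrightarrow> y"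
  shows "(\<lambda>n. trunc_dist (x n) y) \<longlonglongrightarrow> 0"
proof -
  have "(\<lambda>n. min 1 (dist (x n) y)) \<longlonglongrightarrow> min 1 (dist y y)"
    by (intro tendsto_intros assms)
  then show ?thesis
    by (simp add: trunc_dist_def)
qed

text \<open>The length of a path bounds the distance between its ends, so a path of finite total
  truncated length is Cauchy.\<close>

lemma Cauchy_if_summable_trunc_dist:
  assumes "summable (\<lambda>n. trunc_dist (x n) (x (Suc n)))"
  shows "Cauchy x"
proof -
  have path: "trunc_dist (x n) (x (n + j)) \<le> (\<Sum>i\<in>{n..<n + j}. trunc_dist (x i) (x (Suc i)))" for n j
  proof (induction j)
    case (Suc j)
    then show ?case
      using trunc_dist_triangle[of "x n" "x (Suc (n + j))" "x (n + j)"] by simp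
  qed simp
  show ?thesis
    unfolding Cauchy_altdef
  proof (intro allI impI)
    fix e :: real assume "0 < e"
    then obtain N where N: "\<And>m n. N \<le> m \<Longrightarrow>
        norm (\<Sum>i\<in>{m..<n}. trunc_dist (x i) (x (Suc i))) < min 1 e"
      using assms unfolding summable_Cauchy by (meson min_less_iff_conj zero_less_one)
    show "\<exists>N. \<forall>m\<ge>N. \<forall>n>m. dist (x m) (x n) < e"
    proof (intro exI allI impI)
      fix m n assume "N \<le> m" "m < n"
      then have "trunc_dist (x m) (x n) < min 1 e"
        using path[of m "n - m"] N[of m n] by (simp add: sum_nonneg)
      then show "dist (x m) (x n) < e"
        by (auto simp: trunc_dist_def)
    qed
  qed
qed

lemma mean_dist_nonneg [simp]: "0 \<le> mean_dist M X Y"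
  unfolding mean_dist_def by (intro integral_nonneg_AE) auto

context prob_space
begin

lemma integrable_trunc_dist:
  fixes X Y :: "'a \<Rightarrow> 'b::{metric_space, second_countable_topology}"
  assumes [measurable]: "X \<in> borel_measurable M" "Y \<in> borel_measurable M"
  shows "integrable M (\<lambda>\<omega>. trunc_dist (X \<omega>) (Y \<omega>))"
  by (rule integrable_const_bound[of _ 1]) auto

lemma mean_dist_triangle:
  fixes X Y V :: "'a \<Rightarrow> 'b::{metric_space, second_countable_topology}"
  assumes "X \<in> borel_measurable M" "Y \<in> borel_measurable M" "V \<in> borel_measurable M"
  shows "mean_dist M X V \<le> mean_dist M X Y + mean_dist M Y V"
proof -
  have "mean_dist M X V \<le> (\<integral>\<omega>. trunc_dist (X \<omega>) (Y \<omega>) + trunc_dist (Y \<omega>) (V \<omega>) \<partial>M)"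
    unfolding mean_dist_def
    by (intro integral_mono integrable_trunc_dist Bochner_Integration.integrable_add assms
        trunc_dist_triangle)
  then show ?thesis
    by (simp add: mean_dist_def integrable_trunc_dist assms)
qed

lemma mean_dist_tendsto_0_if_AE_tendsto:
  fixes X :: "nat \<Rightarrow> 'a \<Rightarrow> 'b::{metric_space, second_countable_topology}"
  assumes [measurable]: "\<And>n. X n \<in> borel_measurable M" "Y \<in> borel_measurable M"
    and "AE \<omega> in M. (\<lambda>n. X n \<omega>) \<longlonglongrightarrow> Y \<omega>"
  shows "(\<lambda>n. mean_dist M (X n) Y) \<longlonglongrightarrow> 0"
proof -
  have "(\<lambda>n. mean_dist M (X n) Y) \<longlonglongrightarrow> (\<integral>\<omega>. 0 \<partial>M)"
    unfolding mean_dist_def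
  proof (rule integral_dominated_convergence[where w="\<lambda>_. 1"])
    show "AE \<omega> in M. (\<lambda>n. trunc_dist (X n \<omega>) (Y \<omega>)) \<longlonglongrightarrow> 0"
      using assms(3) by eventually_elim (rule trunc_dist_tendsto_0_if_tendsto)
  qed auto
  then show ?thesis by simp
qed

text \<open>Small means give small probabilities by Markov's inequality. Conversely, the mean is at
  most \<open>\<epsilon>\<close> plus the probability that the distance exceeds \<open>\<epsilon>\<close>, because the integrand
  never exceeds 1.\<close>

lemma converges_in_prob_iff_mean_dist:
  fixes X :: "nat \<Rightarrow> 'a \<Rightarrow> 'b::{metric_space, second_countable_topology}"
  assumes [measurable]: "\<And>n. X n \<in> borel_measurable M" "Y \<in> borel_measurable M"
  shows "converges_in_prob M X Y \<longleftrightarrow> (\<lambda>n. mean_dist M (X n) Y) \<longlonglongrightarrow> 0"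
proof
  assume lim: "converges_in_prob M X Y"
  have bound: "mean_dist M (X n) Y \<le> \<epsilon> + prob {\<omega> \<in> space M. dist (X n \<omega>) (Y \<omega>) > \<epsilon>}"
    if "0 < \<epsilon>" for n \<epsilon>
  proof -
    let ?A = "{\<omega> \<in> space M. dist (X n \<omega>) (Y \<omega>) > \<epsilon>}"
    have A [measurable]: "?A \<in> sets M" by measurable
    have intA: "integrable M (indicator ?A :: 'a \<Rightarrow> real)"
      by (rule integrable_const_bound[of _ 1]) auto
    have "mean_dist M (X n) Y \<le> (\<integral>\<omega>. \<epsilon> + indicator ?A \<omega> \<partial>M)"
      unfolding mean_dist_def
    proof (rule integral_mono)
      show "trunc_dist (X n \<omega>) (Y \<omega>) \<le> \<epsilon> + indicator ?A \<omega>" if "\<omega> \<in> space M" for \<omega>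
        using that \<open>0 < \<epsilon>\<close> by (auto simp: trunc_dist_def indicator_def)
    qed (use intA in \<open>auto intro!: integrable_trunc_dist\<close>)
    also have "\<dots> = \<epsilon> + prob ?A"
      using intA by (simp add: prob_space)
    finally show ?thesis .
  qed
  show "(\<lambda>n. mean_dist M (X n) Y) \<longlonglongrightarrow> 0"
  proof (rule tendstoI)
    fix e :: real assume "0 < e"
    then have "(\<lambda>n. prob {\<omega> \<in> space M. dist (X n \<omega>) (Y \<omega>) > e/2}) \<longlonglongrightarrow> 0"
      using lim unfolding converges_in_prob_def by (meson half_gt_zero)
    then have "\<forall>\<^sub>F n in sequentially. prob {\<omega> \<in> space M. dist (X n \<omega>) (Y \<omega>) > e/2} < e/2"
      using \<open>0 < e\<close> by (intro order_tendstoD) auto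
    then show "\<forall>\<^sub>F n in sequentially. dist (mean_dist M (X n) Y) 0 < e"
    proof eventually_elim
      case (elim n)
      then show ?case
        using bound[of "e/2" n] \<open>0 < e\<close> by simp
    qed
  qed
next
  assume lim: "(\<lambda>n. mean_dist M (X n) Y) \<longlonglongrightarrow> 0"
  show "converges_in_prob M X Y"
    unfolding converges_in_prob_def
  proof (intro allI impI)
    fix \<epsilon> :: real assume "0 < \<epsilon>"
    \<comment> \<open>The threshold is truncated as well, since the truncated distance never exceeds 1 and so
      could not detect an \<open>\<epsilon>\<close> above 1.\<close>
    have "prob {\<omega> \<in> space M. dist (X n \<omega>) (Y \<omega>) > \<epsilon>} \<le> mean_dist M (X n) Y / min 1 \<epsilon>" for n
    proof -
      have "prob {\<omega> \<in> space M. dist (X n \<omega>) (Y \<omega>) > \<epsilon>}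
          \<le> prob {\<omega> \<in> space M. trunc_dist (X n \<omega>) (Y \<omega>) \<ge> min 1 \<epsilon>}"
        by (intro finite_measure_mono) (auto simp: trunc_dist_def)
      also have "\<dots> \<le> mean_dist M (X n) Y / min 1 \<epsilon>"
        unfolding mean_dist_def using \<open>0 < \<epsilon>\<close>
        by (intro integral_Markov_inequality_measure[of _ _ "{}"] integrable_trunc_dist) auto
      finally show ?thesis .
    qed
    then have "\<forall>\<^sub>F n in sequentially. norm (prob {\<omega> \<in> space M. dist (X n \<omega>) (Y \<omega>) > \<epsilon>})
        \<le> mean_dist M (X n) Y / min 1 \<epsilon>"
      by simp
    moreover have "(\<lambda>n. mean_dist M (X n) Y / min 1 \<epsilon>) \<longlonglongrightarrow> 0"
      using lim by (rule tendsto_divide_zero)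
    ultimately show "(\<lambda>n. prob {\<omega> \<in> space M. dist (X n \<omega>) (Y \<omega>) > \<epsilon>}) \<longlonglongrightarrow> 0"
      by (rule Lim_null_comparison)
  qed
qed

section \<open>Completeness\<close>

text \<open>The expected total truncated length of the path through the \<open>X n\<close> is the sum of the
  mean gaps, which is finite; so the path has finite length almost surely.\<close>

lemma AE_Cauchy_if_mean_dist_le_geometric:
  fixes X :: "nat \<Rightarrow> 'a \<Rightarrow> 'b::{metric_space, second_countable_topology}"
  assumes [measurable]: "\<And>n. X n \<in> borel_measurable M"
    and geo: "\<And>n. mean_dist M (X n) (X (Suc n)) \<le> (1/2) ^ n"
  shows "AE \<omega> in M. Cauchy (\<lambda>n. X n \<omega>)"
proof -
  let ?d = "\<lambda>n \<omega>. trunc_dist (X n \<omega>) (X (Suc n) \<omega>)"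
  have "(\<integral>\<^sup>+\<omega>. (\<Sum>n. ennreal (?d n \<omega>)) \<partial>M) = (\<Sum>n. \<integral>\<^sup>+\<omega>. ennreal (?d n \<omega>) \<partial>M)"
    by (rule nn_integral_suminf) measurable
  also have "\<dots> = (\<Sum>n. ennreal (mean_dist M (X n) (X (Suc n))))"
    unfolding mean_dist_def
    by (intro suminf_cong nn_integral_eq_integral integrable_trunc_dist) auto
  also have "\<dots> \<le> (\<Sum>n. ennreal ((1/2) ^ n))"
    by (intro suminf_le ennreal_leI geo) auto
  also have "\<dots> < \<infinity>"
    by (subst suminf_ennreal2) (auto intro!: summable_geometric)
  finally have "AE \<omega> in M. (\<Sum>n. ennreal (?d n \<omega>)) \<noteq> \<infinity>"
    by (intro nn_integral_PInf_AE) auto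
  then show ?thesis
  proof eventually_elim
    case (elim \<omega>)
    then have "summable (\<lambda>n. ?d n \<omega>)"
      by (intro summable_suminf_not_top) (auto simp: top_ennreal.rep_eq)
    then show ?case
      by (rule Cauchy_if_summable_trunc_dist)
  qed
qed

lemma measurable_limit_if_AE_Cauchy:
  fixes X :: "nat \<Rightarrow> 'a \<Rightarrow> 'b::polish_space"
  assumes [measurable]: "\<And>n. X n \<in> borel_measurable M"
    and "AE \<omega> in M. Cauchy (\<lambda>n. X n \<omega>)"
  obtains Y where "Y \<in> borel_measurable M" "AE \<omega> in M. (\<lambda>n. X n \<omega>) \<longlonglongrightarrow> Y \<omega>"
proof -
  fix c :: 'b
  \<comment> \<open>Off the measurable set where the sequence is Cauchy, it is replaced by a constant one, so
    that a limit exists everywhere.\<close>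
  let ?X = "\<lambda>n \<omega>. if Cauchy (\<lambda>i. X i \<omega>) then X n \<omega> else c"
  define Y where "Y \<omega> = lim (\<lambda>n. ?X n \<omega>)" for \<omega>
  have lim: "(\<lambda>n. ?X n \<omega>) \<longlonglongrightarrow> Y \<omega>" for \<omega>
    unfolding Y_def
    by (cases "Cauchy (\<lambda>i. X i \<omega>)") (auto simp: convergent_LIMSEQ_iff[symmetric] Cauchy_convergent)
  show thesis
  proof
    show "Y \<in> borel_measurable M"
      by (rule borel_measurable_LIMSEQ_metric[OF _ lim]) measurable
    show "AE \<omega> in M. (\<lambda>n. X n \<omega>) \<longlonglongrightarrow> Y \<omega>"
      using assms(2)
    proof eventually_elim
      case (elim \<omega>)
      then show ?case using lim[of \<omega>] by simp
    qed
  qed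
qed

text \<open>A subsequence with geometrically decreasing gaps converges almost surely, and a Cauchy
  sequence has the same limit as any of its subsequences.\<close>

lemma mean_dist_complete:
  fixes X :: "nat \<Rightarrow> 'a \<Rightarrow> 'b::polish_space"
  assumes [measurable]: "\<And>n. X n \<in> borel_measurable M"
    and Cauchy: "\<And>\<epsilon>. 0 < \<epsilon> \<Longrightarrow> \<exists>N. \<forall>i\<ge>N. \<forall>j\<ge>N. mean_dist M (X i) (X j) < \<epsilon>"
  obtains Y where "Y \<in> borel_measurable M" "(\<lambda>n. mean_dist M (X n) Y) \<longlonglongrightarrow> 0"
proof -
  have "\<exists>N. \<forall>i\<ge>N. \<forall>j\<ge>N. mean_dist M (X i) (X j) < (1/2) ^ n" for n
    by (rule Cauchy) simp
  then obtain N where N: "\<And>n i j. N n \<le> i \<Longrightarrow> N n \<le> j \<Longrightarrow> mean_dist M (X i) (X j) < (1/2) ^ n"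
    by metis
  have "\<exists>r. \<forall>n. N n \<le> r n \<and> r n < r (Suc n)"
  proof (rule dependent_nat_choice)
    fix x n show "\<exists>y\<ge>N (Suc n). x < y"
      by (rule exI[of _ "max (N (Suc n)) (Suc x)"]) auto
  qed auto
  then obtain r where r: "\<And>n. N n \<le> r n" "\<And>n. r n < r (Suc n)"
    by blast
  then have mono: "strict_mono r"
    by (simp add: strict_mono_Suc_iff)
  have "mean_dist M (X (r n)) (X (r (Suc n))) \<le> (1/2) ^ n" for n
    using r(1)[of n] r(2)[of n] by (intro less_imp_le[OF N]) auto
  then have "AE \<omega> in M. Cauchy (\<lambda>n. X (r n) \<omega>)"
    by (intro AE_Cauchy_if_mean_dist_le_geometric) auto
  then obtain Y where Y [measurable]: "Y \<in> borel_measurable M"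
    and AE: "AE \<omega> in M. (\<lambda>n. X (r n) \<omega>) \<longlonglongrightarrow> Y \<omega>"
    using measurable_limit_if_AE_Cauchy[of "\<lambda>n. X (r n)"] by auto
  have sub: "(\<lambda>n. mean_dist M (X (r n)) Y) \<longlonglongrightarrow> 0"
    by (intro mean_dist_tendsto_0_if_AE_tendsto AE) auto
  have "(\<lambda>n. mean_dist M (X n) Y) \<longlonglongrightarrow> 0"
  proof (rule LIMSEQ_I)
    fix e :: real assume "0 < e"
    then obtain K where K: "\<And>i j. K \<le> i \<Longrightarrow> K \<le> j \<Longrightarrow> mean_dist M (X i) (X j) < e/2"
      using Cauchy[of "e/2"] by auto
    obtain L where L: "\<And>n. L \<le> n \<Longrightarrow> mean_dist M (X (r n)) Y < e/2"
      using order_tendstoD(2)[OF sub, of "e/2"] \<open>0 < e\<close> by (auto simp: eventually_sequentially)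
    define k where "k = max K L"
    have "K \<le> r k"
      using seq_suble[OF mono, of k] by (simp add: k_def)
    have "mean_dist M (X n) Y < e" if "K \<le> n" for n
      using mean_dist_triangle[of "X n" "X (r k)" Y] K[OF that \<open>K \<le> r k\<close>] L[of k]
      by (simp add: k_def)
    then show "\<exists>n0. \<forall>n\<ge>n0. norm (mean_dist M (X n) Y - 0) < e"
      by auto
  qed
  with Y show thesis by (rule that)
qed

section \<open>Weak limits on the diagonal\<close>

lemma common_AE_convergent_subseq:
  fixes X X' :: "nat \<Rightarrow> 'a \<Rightarrow> 'b::{metric_space, second_countable_topology}"
  assumes [measurable]: "\<And>n. X n \<in> borel_measurable M" "\<And>n. X' n \<in> borel_measurable M"
    "Y \<in> borel_measurable M"
    and lim: "(\<lambda>n. mean_dist M (X n) Y) \<longlonglongrightarrow> 0" "(\<lambda>n. mean_dist M (X' n) Y) \<longlonglongrightarrow> 0"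
  obtains r :: "nat \<Rightarrow> nat" where "strict_mono r"
    "AE \<omega> in M. (\<lambda>n. X (r n) \<omega>) \<longlonglongrightarrow> Y \<omega> \<and> (\<lambda>n. X' (r n) \<omega>) \<longlonglongrightarrow> Y \<omega>"
proof -
  \<comment> \<open>One subsequence serves both sequences because it is chosen for the sum of the two
    distances.\<close>
  let ?u = "\<lambda>n \<omega>. trunc_dist (X n \<omega>) (Y \<omega>) + trunc_dist (X' n \<omega>) (Y \<omega>)"
  have int: "integrable M (?u n)" for n
    by (intro Bochner_Integration.integrable_add integrable_trunc_dist) auto
  have "(\<integral>\<omega>. norm (?u n \<omega>) \<partial>M) = mean_dist M (X n) Y + mean_dist M (X' n) Y" for n
    by (simp add: mean_dist_def integrable_trunc_dist)
  then have "(\<lambda>n. \<integral>\<omega>. norm (?u n \<omega>) \<partial>M) \<longlonglongrightarrow> 0"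
    using tendsto_add[OF lim] by simp
  from tendsto_L1_AE_subseq[OF int this] obtain r :: "nat \<Rightarrow> nat"
    where "strict_mono r" and AE: "AE \<omega> in M. (\<lambda>n. ?u (r n) \<omega>) \<longlonglongrightarrow> 0"
    by blast
  show thesis
  proof
    show "AE \<omega> in M. (\<lambda>n. X (r n) \<omega>) \<longlonglongrightarrow> Y \<omega> \<and> (\<lambda>n. X' (r n) \<omega>) \<longlonglongrightarrow> Y \<omega>"
      using AE
    proof eventually_elim
      case (elim \<omega>)
      have "(\<lambda>n. trunc_dist (X (r n) \<omega>) (Y \<omega>)) \<longlonglongrightarrow> 0" "(\<lambda>n. trunc_dist (X' (r n) \<omega>) (Y \<omega>)) \<longlonglongrightarrow> 0"
        by (rule Lim_null_comparison[OF _ elim], simp)+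
      then show ?case
        by (simp add: tendsto_if_trunc_dist_tendsto_0)
    qed
  qed fact
qed

lemma converges_in_distr_if_AE_tendsto:
  fixes X :: "nat \<Rightarrow> 'a \<Rightarrow> 'b::metric_space"
  assumes [measurable]: "\<And>n. X n \<in> borel_measurable M" "Y \<in> borel_measurable M"
    and AE: "AE \<omega> in M. (\<lambda>n. X n \<omega>) \<longlonglongrightarrow> Y \<omega>"
  shows "converges_in_distr M X M Y"
  unfolding converges_in_distr_def weakly_converges_def
proof (intro allI impI)
  fix f :: "'b \<Rightarrow> real" assume f: "continuous_on UNIV f \<and> bounded (range f)"
  then have [measurable]: "f \<in> borel_measurable borel"
    by (auto intro: borel_measurable_continuous_onI)
  obtain B where B: "\<And>x. norm (f x) \<le> B"
    using f by (auto simp: bounded_iff)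
  have "(\<lambda>n. \<integral>\<omega>. f (X n \<omega>) \<partial>M) \<longlonglongrightarrow> (\<integral>\<omega>. f (Y \<omega>) \<partial>M)"
  proof (rule integral_dominated_convergence[where w="\<lambda>_. B"])
    show "AE \<omega> in M. (\<lambda>n. f (X n \<omega>)) \<longlonglongrightarrow> f (Y \<omega>)"
      using AE
    proof eventually_elim
      case (elim \<omega>)
      then show ?case
        using f by (auto intro: continuous_on_tendsto_compose[where s=UNIV])
    qed
  qed (use B in auto)
  then show "(\<lambda>n. \<integral>x. f x \<partial>distr M borel (X n)) \<longlonglongrightarrow> (\<integral>x. f x \<partial>distr M borel Y)"
    by (simp add: integral_distr)
qed

text \<open>The limiting random element may be moved to the space of its values, where its law is
  carried by the identity.\<close>

lemma converges_weakly_to_supported_onI: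
  fixes X :: "nat \<Rightarrow> 'a \<Rightarrow> 'b::topological_space"
  assumes [measurable]: "Y \<in> borel_measurable M"
    and "converges_in_distr M X M Y" "\<And>\<omega>. Y \<omega> \<in> D" "D \<in> sets borel"
  shows "converges_weakly_to_supported_on M X D"
  unfolding converges_weakly_to_supported_on_def
proof (intro exI conjI)
  let ?N = "distr M borel Y"
  show "prob_space ?N"
    by (rule prob_space_distr) fact
  show "(\<lambda>x. x) \<in> borel_measurable ?N"
    by simp
  have "distr ?N borel (\<lambda>x. x) = ?N"
    by (rule distr_id2) simp
  then show "converges_in_distr M X ?N (\<lambda>x. x)"
    using assms(2) by (simp add: converges_in_distr_def)
  show "AE x in ?N. x \<in> D"
    using assms by (subst AE_distr_iff) auto
qed

text \<open>The truncated distance is a bounded continuous test function on pairs, and its integral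
  against a law on the diagonal is zero.\<close>

lemma mean_dist_tendsto_0_if_weak_limit_on_diagonal:
  fixes X X' :: "nat \<Rightarrow> 'a \<Rightarrow> 'b::{metric_space, second_countable_topology}"
  assumes [measurable]: "\<And>n. X n \<in> borel_measurable M" "\<And>n. X' n \<in> borel_measurable M"
    and conv: "converges_weakly_to_supported_on M (\<lambda>n \<omega>. (X n \<omega>, X' n \<omega>)) {(x, y). x = y}"
  shows "(\<lambda>n. mean_dist M (X n) (X' n)) \<longlonglongrightarrow> 0"
proof -
  obtain N :: "('b \<times> 'b) measure" and v :: "'b \<times> 'b \<Rightarrow> 'b \<times> 'b"
    where [measurable]: "v \<in> borel_measurable N"
    and lim: "converges_in_distr M (\<lambda>n \<omega>. (X n \<omega>, X' n \<omega>)) N v"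
    and diag: "AE x in N. v x \<in> {(x, y). x = y}"
    using conv by (auto simp: converges_weakly_to_supported_on_def)
  let ?f = "\<lambda>p::'b \<times> 'b. trunc_dist (fst p) (snd p)"
  have [measurable]: "?f \<in> borel_measurable borel"
    by (rule borel_measurable_continuous_onI[OF continuous_on_trunc_dist])
  have [measurable]: "(\<lambda>\<omega>. (X n \<omega>, X' n \<omega>)) \<in> borel_measurable M" for n
    by (rule borel_measurable_Pair) fact+
  have "bounded (range ?f)"
    by (auto simp: bounded_iff intro!: exI[of _ 1])
  then have "(\<lambda>n. \<integral>p. ?f p \<partial>distr M borel (\<lambda>\<omega>. (X n \<omega>, X' n \<omega>))) \<longlonglongrightarrow> (\<integral>p. ?f p \<partial>distr N borel v)"
    using lim continuous_on_trunc_dist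
    unfolding converges_in_distr_def weakly_converges_def by blast
  moreover have "(\<integral>p. ?f p \<partial>distr N borel v) = 0"
  proof -
    have "(\<integral>p. ?f p \<partial>distr N borel v) = (\<integral>x. ?f (v x) \<partial>N)"
      by (rule integral_distr) measurable
    also have "\<dots> = (\<integral>x. 0 \<partial>N)"
      using diag by (intro integral_cong_AE) (auto elim!: eventually_mono)
    finally show ?thesis by simp
  qed
  ultimately show ?thesis
    by (simp add: integral_distr mean_dist_def)
qed

text \<open>If the Cauchy property fails at \<open>\<epsilon>\<close>, pairs of indices at mean distance at least
  \<open>\<epsilon>\<close> occur arbitrarily far out. Choosing them recursively, with both indices increasing,
  yields two subsequences for which the preceding lemma is violated along every further
  subsequence.\<close>

lemma mean_dist_Cauchy_if_weak_limits_on_diagonal: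
  fixes Z :: "nat \<Rightarrow> 'a \<Rightarrow> 'b::{metric_space, second_countable_topology}"
  assumes [measurable]: "\<And>n. Z n \<in> borel_measurable M"
    and sub: "\<And>l m :: nat \<Rightarrow> nat. strict_mono l \<Longrightarrow> strict_mono m \<Longrightarrow>
      \<exists>r :: nat \<Rightarrow> nat. strict_mono r \<and>
        converges_weakly_to_supported_on M
          (\<lambda>k \<omega>. (Z (l (r k)) \<omega>, Z (m (r k)) \<omega>)) {(x, y). x = y}"
    and "0 < \<epsilon>"
  shows "\<exists>N. \<forall>i\<ge>N. \<forall>j\<ge>N. mean_dist M (Z i) (Z j) < \<epsilon>"
proof (rule ccontr)
  assume "\<not> ?thesis"
  then have far: "\<exists>i\<ge>N. \<exists>j\<ge>N. \<epsilon> \<le> mean_dist M (Z i) (Z j)" for N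
    by (meson not_less)
  have "\<exists>p. \<forall>n::nat. \<epsilon> \<le> mean_dist M (Z (fst (p n))) (Z (snd (p n))) \<and>
      (fst (p n) < fst (p (Suc n)) \<and> snd (p n) < snd (p (Suc n)))"
  proof (rule dependent_nat_choice)
    show "\<exists>p. \<epsilon> \<le> mean_dist M (Z (fst p)) (Z (snd p))"
      using far[of 0] by auto
    fix q :: "nat \<times> nat"
    show "\<exists>p. \<epsilon> \<le> mean_dist M (Z (fst p)) (Z (snd p)) \<and> fst q < fst p \<and> snd q < snd p"
    proof -
      obtain i j where "max (fst q) (snd q) < i" "max (fst q) (snd q) < j"
        "\<epsilon> \<le> mean_dist M (Z i) (Z j)"
        using far[of "Suc (max (fst q) (snd q))"] by (auto simp: Suc_le_eq)
      then show ?thesis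
        by (intro exI[of _ "(i, j)"]) auto
    qed
  qed
  then obtain p where p: "\<And>n. \<epsilon> \<le> mean_dist M (Z (fst (p n))) (Z (snd (p n)))"
    "\<And>n. fst (p n) < fst (p (Suc n))" "\<And>n. snd (p n) < snd (p (Suc n))"
    by blast
  obtain r :: "nat \<Rightarrow> nat" where
    "converges_weakly_to_supported_on M
      (\<lambda>k \<omega>. (Z (fst (p (r k))) \<omega>, Z (snd (p (r k))) \<omega>)) {(x, y). x = y}"
    using sub[of "\<lambda>n. fst (p n)" "\<lambda>n. snd (p n)"] p(2,3) by (auto simp: strict_mono_Suc_iff)
  then have "(\<lambda>k. mean_dist M (Z (fst (p (r k)))) (Z (snd (p (r k))))) \<longlonglongrightarrow> 0"
    by (intro mean_dist_tendsto_0_if_weak_limit_on_diagonal) auto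
  then have "\<epsilon> \<le> 0"
    by (rule LIMSEQ_le_const) (use p(1) in blast)
  with \<open>0 < \<epsilon>\<close> show False by simp
qed

end

section \<open>The criterion\<close>

theorem lemma1p1:
  fixes M :: "'w measure" and Z :: "nat \<Rightarrow> 'w \<Rightarrow> 'a::polish_space"
  assumes "prob_space M"
    and "\<And>n. Z n \<in> borel_measurable M"
  shows "(\<exists>Y \<in> borel_measurable M. converges_in_prob M Z Y) \<longleftrightarrow>
    (\<forall>l m :: nat \<Rightarrow> nat. strict_mono l \<and> strict_mono m \<longrightarrow>
      (\<exists>r :: nat \<Rightarrow> nat. strict_mono r \<and>
        converges_weakly_to_supported_on M
          (\<lambda>k \<omega>. (Z (l (r k)) \<omega>, Z (m (r k)) \<omega>)) {(x, y). x = y}))"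
proof -
  interpret prob_space M by fact
  note [measurable] = assms(2)
  show ?thesis
  proof (intro iffI allI impI)
    fix l m :: "nat \<Rightarrow> nat"
    assume "\<exists>Y \<in> borel_measurable M. converges_in_prob M Z Y"
      and lm: "strict_mono l \<and> strict_mono m"
    then obtain Y where Y [measurable]: "Y \<in> borel_measurable M"
      and lim: "(\<lambda>n. mean_dist M (Z n) Y) \<longlonglongrightarrow> 0"
      by (auto simp: converges_in_prob_iff_mean_dist)
    have "(\<lambda>k. mean_dist M (Z (l k)) Y) \<longlonglongrightarrow> 0" "(\<lambda>k. mean_dist M (Z (m k)) Y) \<longlonglongrightarrow> 0"
      using LIMSEQ_subseq_LIMSEQ[OF lim] lm by (auto simp: o_def)
    then obtain r :: "nat \<Rightarrow> nat" where r: "strict_mono r"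
      and AE: "AE \<omega> in M. (\<lambda>k. Z (l (r k)) \<omega>) \<longlonglongrightarrow> Y \<omega> \<and> (\<lambda>k. Z (m (r k)) \<omega>) \<longlonglongrightarrow> Y \<omega>"
      by (rule common_AE_convergent_subseq[of "\<lambda>k. Z (l k)" "\<lambda>k. Z (m k)" Y, rotated 3]) auto
    have meas: "(\<lambda>\<omega>. (Y \<omega>, Y \<omega>)) \<in> borel_measurable M"
      "\<And>k. (\<lambda>\<omega>. (Z (l (r k)) \<omega>, Z (m (r k)) \<omega>)) \<in> borel_measurable M"
      by (intro borel_measurable_Pair; measurable)+
    have "{(x::'a, y). x = y} \<in> sets borel"
    proof -
      have "{(x::'a, y). x = y} = {p. \<exists>x. p = (x, x)}"
        by auto
      then show ?thesis
        by (simp add: closed_diagonal)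
    qed
    moreover have "converges_in_distr M (\<lambda>k \<omega>. (Z (l (r k)) \<omega>, Z (m (r k)) \<omega>)) M (\<lambda>\<omega>. (Y \<omega>, Y \<omega>))"
    proof (rule converges_in_distr_if_AE_tendsto[OF meas(2,1)])
      show "AE \<omega> in M. (\<lambda>k. (Z (l (r k)) \<omega>, Z (m (r k)) \<omega>)) \<longlonglongrightarrow> (Y \<omega>, Y \<omega>)"
        using AE by eventually_elim (auto intro: tendsto_Pair)
    qed
    ultimately show "\<exists>r :: nat \<Rightarrow> nat. strict_mono r \<and>
        converges_weakly_to_supported_on M
          (\<lambda>k \<omega>. (Z (l (r k)) \<omega>, Z (m (r k)) \<omega>)) {(x, y). x = y}"
      using r converges_weakly_to_supported_onI[OF meas(1)] by auto
  next
    assume "\<forall>l m :: nat \<Rightarrow> nat. strict_mono l \<and> strict_mono m \<longrightarrow>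
      (\<exists>r :: nat \<Rightarrow> nat. strict_mono r \<and>
        converges_weakly_to_supported_on M
          (\<lambda>k \<omega>. (Z (l (r k)) \<omega>, Z (m (r k)) \<omega>)) {(x, y). x = y})"
    then have "\<exists>N. \<forall>i\<ge>N. \<forall>j\<ge>N. mean_dist M (Z i) (Z j) < \<epsilon>" if "0 < \<epsilon>" for \<epsilon>
      using that by (intro mean_dist_Cauchy_if_weak_limits_on_diagonal) auto
    from mean_dist_complete[OF assms(2) this] obtain Y
      where "Y \<in> borel_measurable M" "(\<lambda>n. mean_dist M (Z n) Y) \<longlonglongrightarrow> 0"
      by blast
    then show "\<exists>Y \<in> borel_measurable M. converges_in_prob M Z Y"
      by (auto simp: converges_in_prob_iff_mean_dist)
  qed
qed

end
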